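(* Let $\mathcal{C}$ be a class of topological spaces. The following conditions are equivalent. (i) $\mathcal{C}$ is compactifiable. (ii) There is a metrizable compactum $A$ and a closed equivalence relation $E \subseteq A \times A$ such that $\{E^a : a \in A\} \cong \mathcal{C} \setminus \{\emptyset\}$. (iii) There is a metrizable compactum $A$, a metrizable $\sigma$-compact space $B$, and a closed set $F \subseteq A \times B$ such that $\{F^b : b \in B\} \cong \mathcal{C}$. (iv) There is a closed set $F \subseteq [0,1]^\omega \times 2^\omega$ such that $\{F^b : b \in 2^\omega\} \cong \mathcal{C}$, or $\mathcal{C} = \emptyset$.
   Context: A metrizable compactum is a compact metrizable space; the empty space is allowed. Two classes $\mathcal{C},\mathcal{D}$ of topological spaces (not necessarily closed under homeomorphic copies) are equivalent, written $\mathcal{C}\cong\mathcal{D}$, if every space in $\mathcal{C}$ is homeomorphic to a space in $\mathcal{D}$ and vice versa. A family of subsets of a topological space is regarded as a class of topological spaces by giving each member the subspace topology. A class $\mathcal{C}$ is compactifiable if there is a continuous (not necessarily surjective) map $q\colon A\to B$ between metrizable compacta such that $\{q^{-1}(b): b\in B\}\cong\mathcal{C}$. For $F\subseteq A\times B$ and $b\in B$, $F^b=\{a\in A: (a,b)\in F\}$ is the section of $F$ through $b$; likewise $E^a=\{a'\in A:(a',a)\in E\}$. *)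

theory Defs
  imports "HOL-Analysis.Analysis"
begin

text \<open>
  A class of topological spaces is a set of abstract topologies whose points are taken from a
  type; for different classes these types may differ. A family of subsets of a space is turned
  into a class of spaces by \<open>subspaces\<close>.
\<close>

definition equivalent_classes :: "'a topology set \<Rightarrow> 'b topology set \<Rightarrow> bool"
    (infix "\<approx>\<^sub>T" 50) where
  "\<C> \<approx>\<^sub>T \<D> \<longleftrightarrow>
     (\<forall>X\<in>\<C>. \<exists>Y\<in>\<D>. X homeomorphic_space Y) \<and>
     (\<forall>Y\<in>\<D>. \<exists>X\<in>\<C>. Y homeomorphic_space X)"

definition subspaces :: "'a topology \<Rightarrow> 'a set set \<Rightarrow> 'a topology set" where
  "subspaces X \<S> = subtopology X ` \<S>"

definition metrizable_compactum :: "'a topology \<Rightarrow> bool" where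
  "metrizable_compactum X \<longleftrightarrow> compact_space X \<and> metrizable_space X"

definition sigma_compact_space :: "'a topology \<Rightarrow> bool" where
  "sigma_compact_space X \<longleftrightarrow>
     (\<exists>K :: nat \<Rightarrow> 'a set. (\<forall>n. compactin X (K n)) \<and> topspace X = (\<Union>n. K n))"

definition fibre :: "'a topology \<Rightarrow> ('a \<Rightarrow> 'b) \<Rightarrow> 'b \<Rightarrow> 'a set" where
  "fibre X q b = {a \<in> topspace X. q a = b}"

definition section_through :: "'a topology \<Rightarrow> ('a \<times> 'b) set \<Rightarrow> 'b \<Rightarrow> 'a set" where
  "section_through X F b = {a \<in> topspace X. (a, b) \<in> F}"

text \<open>
  HOL cannot quantify existentially over types, so the type \<open>'u\<close> from which the points of the
  witnessing compacta are taken is a parameter. The notion is the intended one as soon as \<open>'u\<close>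
  has at least continuum many elements: metrizable compacta, and more generally \<open>\<sigma>\<close>-compact
  metrizable spaces, have at most continuum many points, so each of them is homeomorphic to an
  abstract topology over \<open>'u\<close>.
\<close>

definition compactifiable :: "'u itself \<Rightarrow> 'a topology set \<Rightarrow> bool" where
  "compactifiable U \<C> \<longleftrightarrow>
     (\<exists>(A :: 'u topology) (B :: 'u topology) q.
        metrizable_compactum A \<and> metrizable_compactum B \<and> continuous_map A B q \<and>
        subspaces A {fibre A q b | b. b \<in> topspace B} \<approx>\<^sub>T \<C>)"

definition hilbert_cube :: "(nat \<Rightarrow> real) topology" where
  "hilbert_cube = product_topology (\<lambda>_. top_of_set {0..1}) UNIV"

definition cantor_space :: "(nat \<Rightarrow> bool) topology" where
  "cantor_space = product_topology (\<lambda>_. discrete_topology UNIV) UNIV"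

end

theory Submission imports Defs begin

text \<open>
  All four conditions realize the members of \<open>\<C>\<close>, up to the empty space, as sections of one closed
  set. A map \<open>q\<close> between compacta gives its graph, a closed set in \<open>A \<times> B\<close> whose sections are the
  fibres, and its kernel, a closed equivalence relation whose classes are the nonempty fibres
  (\<open>compactifiable_imp_family\<close>, \<open>compactifiable_imp_equivalence_relation\<close>). Conversely, a closed set
  \<open>F\<close> in the product of the Hilbert cube and the Cantor space is compact, and its sections are
  homeomorphic to the fibres of the projection \<open>F \<rightarrow> 2\<^sup>\<omega>\<close> (\<open>cube_family_imp_compactifiable\<close>).

  What remains is to bring an arbitrary closed \<open>F \<subseteq> A \<times> B\<close> with \<open>A\<close> compact and \<open>B\<close> nonempty and
  \<open>\<sigma>\<close>-compact into the product of the Hilbert cube and the Cantor space without changing the class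
  of its sections (\<open>sections_over_sigma_compact\<close>). An equivalence relation \<open>E \<subseteq> A \<times> A\<close> is the case
  \<open>B = A\<close>, up to adding an empty section. The compactum \<open>A\<close> embeds in the Hilbert cube. If \<open>B\<close> is
  compact, it is a continuous image of the Cantor space, and \<open>F\<close> can be pulled back along the
  surjection (\<open>sections_over_compactum\<close>). In general \<open>B\<close> is a union of countably many compact pieces,
  and the resulting families have to be joined into one (\<open>sections_countable_union\<close>). They are
  placed over disjoint clopen subsets of the Cantor space that converge to a single point. The
  section over this point must be a member of the class as well and must absorb all limits; this is
  achieved by taking a copy of one of the nonempty sections there, and by shrinking the other
  families towards one of its points.
\<close>

section \<open>Closed sets and closed graphs\<close>

lemma closedin_le_constant:
  fixes f :: "'a \<Rightarrow> real"
  assumes "continuous_map X euclideanreal f"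
  shows "closedin X {x \<in> topspace X. f x \<le> c}" "closedin X {x \<in> topspace X. c \<le> f x}"
  using closedin_continuous_map_preimage[OF assms, of "{..c}"]
    closedin_continuous_map_preimage[OF assms, of "{c..}"] by simp_all

lemma closedin_Collect_all:
  assumes "\<And>i. closedin X {x \<in> topspace X. P i x}"
  shows "closedin X {x \<in> topspace X. \<forall>i. P i x}"
proof -
  have "{x \<in> topspace X. \<forall>i. P i x} = (\<Inter>i. {x \<in> topspace X. P i x})"
    by blast
  then show ?thesis
    using assms by (simp add: closedin_INT)
qed

lemma closedin_Collect_imp:
  assumes "Q \<Longrightarrow> closedin X {x \<in> topspace X. P x}"
  shows "closedin X {x \<in> topspace X. Q \<longrightarrow> P x}"
  using assms by (cases Q) simp_all

lemma closedin_Collect_conj: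
  assumes "closedin X {x \<in> topspace X. P x}" "closedin X {x \<in> topspace X. Q x}"
  shows "closedin X {x \<in> topspace X. P x \<and> Q x}"
proof -
  have "{x \<in> topspace X. P x \<and> Q x} = {x \<in> topspace X. P x} \<inter> {x \<in> topspace X. Q x}"
    by blast
  then show ?thesis
    using assms by (simp add: closedin_Int)
qed

lemma closedin_Collect_disj:
  assumes "closedin X {x \<in> topspace X. P x}" "closedin X {x \<in> topspace X. Q x}"
  shows "closedin X {x \<in> topspace X. P x \<or> Q x}"
proof -
  have "{x \<in> topspace X. P x \<or> Q x} = {x \<in> topspace X. P x} \<union> {x \<in> topspace X. Q x}"
    by blast
  then show ?thesis
    using assms by (simp add: closedin_Un)
qed

lemma closedin_Collect_bex_finite:
  assumes "finite I" "\<And>i. i \<in> I \<Longrightarrow> closedin X {x \<in> topspace X. P i x}"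
  shows "closedin X {x \<in> topspace X. \<exists>i\<in>I. P i x}"
proof -
  have "{x \<in> topspace X. \<exists>i\<in>I. P i x} = (\<Union>i\<in>I. {x \<in> topspace X. P i x})"
    by blast
  then show ?thesis
    using assms closedin_Union[of "(\<lambda>i. {x \<in> topspace X. P i x}) ` I" X] by auto
qed

text \<open>
  The preimage of a closed set \<open>D\<close> is the projection to \<open>X\<close> of the part of the graph that lies
  over \<open>D\<close>, and projecting along a compact factor is a closed map.
\<close>

lemma continuous_map_from_closed_graph:
  assumes "compact_space Y" and "f \<in> topspace X \<rightarrow> topspace Y"
    and graph: "closedin (prod_topology X Y) {(x, y). x \<in> topspace X \<and> y = f x}"
  shows "continuous_map X Y f"
proof -
  have "closedin X {x \<in> topspace X. f x \<in> D}" if "closedin Y D" for D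
  proof -
    have "closedin (prod_topology X Y) ({(x, y). x \<in> topspace X \<and> y = f x} \<inter> topspace X \<times> D)"
      using graph that by (intro closedin_Int) (auto simp: closedin_prod_Times_iff)
    then have "closedin X (fst ` ({(x, y). x \<in> topspace X \<and> y = f x} \<inter> topspace X \<times> D))"
      using Abstract_Topological_Spaces.closed_map_fst[OF \<open>compact_space Y\<close>]
      unfolding closed_map_def by blast
    moreover have "fst ` ({(x, y). x \<in> topspace X \<and> y = f x} \<inter> topspace X \<times> D)
      = {x \<in> topspace X. f x \<in> D}"
      by force
    ultimately show ?thesis by simp
  qed
  then show ?thesis
    using assms(2) unfolding continuous_map_closedin by blast
qed

section \<open>Metrizable compacta and the Hilbert cube\<close>

lemma metrizable_compactum_hilbert_cube: "metrizable_compactum hilbert_cube"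
  unfolding metrizable_compactum_def hilbert_cube_def
  by (auto simp: compact_space_product_topology metrizable_space_product_topology
      compact_space_subtopology metrizable_space_subtopology metrizable_space_euclidean)

lemma metrizable_compactum_cantor_space: "metrizable_compactum cantor_space"
  unfolding metrizable_compactum_def cantor_space_def
  by (auto simp: compact_space_product_topology metrizable_space_product_topology
      compact_space_discrete_topology)

abbreviation cube_family :: "((nat \<Rightarrow> real) \<times> (nat \<Rightarrow> bool)) topology" where
  "cube_family \<equiv> prod_topology hilbert_cube cantor_space"

lemma topspace_cantor_space [simp]: "topspace cantor_space = UNIV"
  by (simp add: cantor_space_def)

lemma topspace_hilbert_cube: "topspace hilbert_cube = {x. \<forall>i. 0 \<le> x i \<and> x i \<le> 1}"
  by (auto simp: hilbert_cube_def PiE_def Pi_def)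

lemma metrizable_compactum_imp_Hausdorff: "metrizable_compactum X \<Longrightarrow> Hausdorff_space X"
  by (simp add: metrizable_compactum_def metrizable_imp_Hausdorff_space)

lemma metrizable_compactum_prod:
  "metrizable_compactum X \<Longrightarrow> metrizable_compactum Y \<Longrightarrow> metrizable_compactum (prod_topology X Y)"
  by (simp add: metrizable_compactum_def metrizable_space_prod_topology compact_space_prod_topology)

lemma metrizable_compactum_closed_subspace:
  "metrizable_compactum X \<Longrightarrow> closedin X S \<Longrightarrow> metrizable_compactum (subtopology X S)"
  by (simp add: metrizable_compactum_def metrizable_space_subtopology closedin_compact_space
      compact_space_subtopology)

lemma continuous_map_into_hilbert_cube:
  "continuous_map X hilbert_cube f \<longleftrightarrow>
     (\<forall>i. continuous_map X euclideanreal (\<lambda>x. f x i)) \<and> (\<forall>x\<in>topspace X. \<forall>i. 0 \<le> f x i \<and> f x i \<le> 1)"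
  by (auto simp: hilbert_cube_def continuous_map_componentwise_UNIV continuous_map_in_subtopology
      Pi_iff)

lemma continuous_map_into_cantor_space:
  "continuous_map X cantor_space f \<longleftrightarrow> (\<forall>i. continuous_map X (discrete_topology UNIV) (\<lambda>x. f x i))"
  by (auto simp: cantor_space_def continuous_map_componentwise_UNIV)

text \<open>
  Total boundedness yields a countable dense set \<open>a\<^sub>0, a\<^sub>1, \<dots>\<close>, and a point is determined by its
  truncated distances \<open>min 1 (d x a\<^sub>i)\<close>: a dense point very close to \<open>x\<close> cannot be as close to
  another point. Continuous injections of compact spaces into Hausdorff spaces are embeddings.
\<close>

lemma metrizable_compactum_embeds_in_hilbert_cube:
  assumes "metrizable_compactum X"
  obtains e where "embedding_map X hilbert_cube e"
proof -
  obtain M d where "Metric_space M d" and X: "X = Metric_space.mtopology M d"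
    using assms by (auto simp: metrizable_compactum_def metrizable_space_def)
  then interpret Metric_space M d by simp
  have "compactin mtopology M"
    using assms X by (simp add: metrizable_compactum_def compact_space_def)
  then have "mtotally_bounded M"
    by (rule compactin_imp_mtotally_bounded)
  then have "\<forall>n. \<exists>D. finite D \<and> D \<subseteq> M \<and> M \<subseteq> (\<Union>a\<in>D. mball a (1 / Suc n))"
    unfolding mtotally_bounded_def by simp
  then obtain D where D: "\<And>n. finite (D n)" "\<And>n. D n \<subseteq> M" "\<And>n. M \<subseteq> (\<Union>a\<in>D n. mball a (1 / Suc n))"
    by metis
  \<comment> \<open>The set \<open>N\<close> is dense, and it is empty only if the space is.\<close>
  define N where "N = (\<Union>n. D n)"
  define a where "a = from_nat_into N"
  define e where "e = (\<lambda>x i. if N = {} then 0 else min 1 (d x (a i)))"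
  have "countable N"
    unfolding N_def using D(1) by (simp add: countable_finite)
  have "N \<subseteq> M"
    using D(2) N_def by auto
  have a: "a i \<in> M" if "N \<noteq> {}" for i
    using from_nat_into[OF that] \<open>N \<subseteq> M\<close> unfolding a_def by blast
  have dist: "continuous_map X euclideanreal (\<lambda>x. d x p)" if "p \<in> M" for p
  proof -
    have "(\<lambda>x. d x p) = d p"
      by (simp add: commute fun_eq_iff)
    then show ?thesis
      using continuous_on_mdist[of p "metric (M, d)"] that X by (simp add: mtopology_of)
  qed
  have "continuous_map X hilbert_cube e"
    using a dist by (auto simp: continuous_map_into_hilbert_cube e_def intro!: continuous_map_real_min)
  moreover have "inj_on e (topspace X)"
  proof (rule inj_onI, rule ccontr)
    fix x y assume x: "x \<in> topspace X" and y: "y \<in> topspace X" and eq: "e x = e y" and "x \<noteq> y"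
    then have xy: "x \<in> M" "y \<in> M" "0 < d x y"
      using X by auto
    then obtain n where n: "1 / Suc n < min 1 (d x y / 2)"
      using nat_approx_posE[of "min 1 (d x y / 2)"] by auto
    obtain c where c: "c \<in> D n" "d c x < 1 / Suc n"
      using D(3)[of n] xy by auto
    then have "c \<in> N" "c \<in> M"
      using D(2) by (auto simp: N_def)
    then obtain i where "a i = c"
      using from_nat_into_surj[OF \<open>countable N\<close>] by (metis a_def)
    then have "min 1 (d x c) = min 1 (d y c)"
      using eq \<open>c \<in> N\<close> unfolding e_def by (metis empty_iff)
    then have "d y c < 1 / Suc n"
      using c n by (auto simp: commute min_def split: if_splits)
    then show False
      using triangle[of x c y] c n xy \<open>c \<in> M\<close> by (auto simp: commute)
  qed
  ultimately have "embedding_map X hilbert_cube e"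
    using assms metrizable_compactum_imp_Hausdorff[OF metrizable_compactum_hilbert_cube]
    by (simp add: T1_Spaces.continuous_imp_embedding_map metrizable_compactum_def)
  then show thesis ..
qed

section \<open>The Cantor space and its continuous images\<close>

lemma closedin_cantor_coordinate:
  assumes "continuous_map X cantor_space f"
  shows "closedin X {x \<in> topspace X. f x n = b}"
proof -
  have "continuous_map X (discrete_topology UNIV) (\<lambda>x. f x n)"
    using assms by (simp add: continuous_map_into_cantor_space)
  from closedin_continuous_map_preimage[OF this, of "{b}"] show ?thesis
    by simp
qed

lemma closedin_cantor_coordinates_eq:
  assumes "continuous_map X cantor_space f" "continuous_map X cantor_space g"
  shows "closedin X {x \<in> topspace X. f x n = g x n}"
  by (rule closedin_continuous_maps_eq[of "discrete_topology UNIV"])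
    (use assms in \<open>auto simp: continuous_map_into_cantor_space\<close>)

text \<open>
  Compare two sequences \<open>z\<close> and \<open>w\<close> at the first place where they differ: \<open>z\<close> is preferred with
  respect to \<open>s\<close> if it is \<open>z\<close> that agrees with \<open>s\<close> there. The condition is spelled out for one place
  \<open>n\<close> at a time because then it involves finitely many coordinates only and is therefore closed.
\<close>

definition lex_preferred_at :: "(nat \<Rightarrow> bool) \<Rightarrow> (nat \<Rightarrow> bool) \<Rightarrow> (nat \<Rightarrow> bool) \<Rightarrow> nat \<Rightarrow> bool" where
  "lex_preferred_at s z w n \<longleftrightarrow> ((\<forall>m<n. z m = w m) \<longrightarrow> z n = w n \<or> z n = s n)"

definition lex_closest :: "(nat \<Rightarrow> bool) set \<Rightarrow> (nat \<Rightarrow> bool) \<Rightarrow> (nat \<Rightarrow> bool) \<Rightarrow> bool" where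
  "lex_closest Z s z \<longleftrightarrow> z \<in> Z \<and> (\<forall>w\<in>Z. \<forall>n. lex_preferred_at s z w n)"

lemma closedin_lex_preferred_at:
  assumes "continuous_map X cantor_space f" "continuous_map X cantor_space g"
  shows "closedin X {x \<in> topspace X. lex_preferred_at (f x) (g x) w n}"
proof -
  have "closedin X {x \<in> topspace X. (\<exists>m\<in>{..<n}. g x m = (\<not> w m)) \<or> g x n = w n \<or> g x n = f x n}"
    using assms by (intro closedin_Collect_disj closedin_Collect_bex_finite
        closedin_cantor_coordinate closedin_cantor_coordinates_eq) auto
  also have "{x \<in> topspace X. (\<exists>m\<in>{..<n}. g x m = (\<not> w m)) \<or> g x n = w n \<or> g x n = f x n}
    = {x \<in> topspace X. lex_preferred_at (f x) (g x) w n}"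
    by (auto simp: lex_preferred_at_def)
  finally show ?thesis .
qed

text \<open>
  The points of \<open>Z\<close> that are preferred at all places below \<open>k\<close> form a decreasing sequence of closed
  sets. They are nonempty by induction on \<open>k\<close>: a point that works below \<open>k\<close> can be exchanged for
  one with the same first \<open>k\<close> values that agrees with \<open>s\<close> at place \<open>k\<close>, if \<open>Z\<close> contains such a
  point. Compactness provides a common point.
\<close>

lemma lex_closest_exists:
  assumes "closedin cantor_space Z" "Z \<noteq> {}"
  shows "\<exists>z. lex_closest Z s z"
proof -
  define C where "C = (\<lambda>k. {z \<in> Z. \<forall>w\<in>Z. \<forall>n<k. lex_preferred_at s z w n})"
  have "closedin cantor_space (C k)" for k
  proof -
    have "C k = Z \<inter> {z \<in> topspace cantor_space.
        \<forall>w. w \<in> Z \<longrightarrow> (\<forall>n. n < k \<longrightarrow> lex_preferred_at s z w n)}"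
      by (auto simp: C_def)
    also have "closedin cantor_space \<dots>"
      by (intro closedin_Int assms closedin_Collect_all closedin_Collect_imp closedin_lex_preferred_at)
        (simp_all add: continuous_map_id[unfolded id_def])
    finally show ?thesis .
  qed
  moreover have "C k \<noteq> {}" for k
  proof (induction k)
    case 0
    then show ?case using assms by (auto simp: C_def)
  next
    case (Suc k)
    then obtain z where z: "z \<in> Z" "\<And>w n. w \<in> Z \<Longrightarrow> n < k \<Longrightarrow> lex_preferred_at s z w n"
      unfolding C_def by blast
    have "\<exists>v\<in>Z. (\<forall>m<k. v m = z m) \<and> (\<forall>w\<in>Z. lex_preferred_at s v w k)"
    proof (cases "\<exists>v\<in>Z. (\<forall>m<k. v m = z m) \<and> v k = s k")
      case True
      then show ?thesis unfolding lex_preferred_at_def by blast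
    next
      \<comment> \<open>All points of \<open>Z\<close> that extend the first \<open>k\<close> values of \<open>z\<close> differ from \<open>s\<close> at \<open>k\<close>,
        so they agree with one another there.\<close>
      case False
      have "lex_preferred_at s z w k" if "w \<in> Z" for w
        unfolding lex_preferred_at_def
      proof (intro impI disjI1)
        assume "\<forall>m<k. z m = w m"
        then have "w k \<noteq> s k" "z k \<noteq> s k"
          using False that z(1) by force+
        then show "z k = w k" by blast
      qed
      then show ?thesis using z(1) by blast
    qed
    then obtain v where v: "v \<in> Z" "\<forall>m<k. v m = z m" "\<And>w. w \<in> Z \<Longrightarrow> lex_preferred_at s v w k"
      by blast
    have "lex_preferred_at s v w n" if "w \<in> Z" "n < Suc k" for w n
    proof (cases "n = k")
      case False
      then have "n < k" "\<forall>m\<le>n. v m = z m"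
        using that v(2) by auto
      then show ?thesis
        using z(2)[OF that(1)] unfolding lex_preferred_at_def by simp
    qed (use v that in simp)
    then show ?case
      using v(1) unfolding C_def by blast
  qed
  moreover have "decseq C"
    unfolding C_def by (rule decseq_SucI) (blast intro: less_SucI)
  ultimately have "(\<Inter>k. C k) \<noteq> {}"
    using metrizable_compactum_cantor_space
    by (intro compact_space_imp_nest[of cantor_space]) (auto simp: metrizable_compactum_def)
  then obtain z where "\<And>k. z \<in> C k" by blast
  then have "lex_closest Z s z"
    unfolding lex_closest_def C_def by blast
  then show ?thesis by blast
qed

text \<open>
  At the first difference of two closest points both would have to agree with \<open>s\<close>.
\<close>

lemma lex_closest_unique:
  assumes "lex_closest Z s z" "lex_closest Z s w"
  shows "z = w"
proof (rule ccontr)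
  assume "z \<noteq> w"
  then have ex: "\<exists>n. z n \<noteq> w n" by blast
  define n where "n = (LEAST n. z n \<noteq> w n)"
  have ne: "z n \<noteq> w n"
    using LeastI_ex[OF ex] unfolding n_def .
  have "\<forall>m<n. z m = w m"
    using not_less_Least[of _ "\<lambda>n. z n \<noteq> w n"] unfolding n_def by blast
  moreover have "lex_preferred_at s z w n" "lex_preferred_at s w z n"
    using assms unfolding lex_closest_def by blast+
  ultimately have "z n = s n" "w n = s n"
    using ne unfolding lex_preferred_at_def by simp_all
  then show False
    using ne by simp
qed

text \<open>
  The retraction sends a point to its lexicographically closest point in \<open>Z\<close>. This relation is
  closed and functional, so it is a continuous map by the closed graph criterion.
\<close>

lemma closed_cantor_subspace_retract:
  assumes "closedin cantor_space Z" "Z \<noteq> {}"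
  obtains r where "continuous_map cantor_space (subtopology cantor_space Z) r" "\<And>z. z \<in> Z \<Longrightarrow> r z = z"
proof -
  obtain r where r: "\<And>s. lex_closest Z s (r s)"
    using lex_closest_exists[OF assms] by metis
  let ?P = "prod_topology cantor_space cantor_space"
  have "z = r s \<longleftrightarrow> lex_closest Z s z" for s z
    using r lex_closest_unique by blast
  then have "{(s, z). s \<in> topspace cantor_space \<and> z = r s} = {p \<in> topspace ?P. snd p \<in> Z \<and>
     (\<forall>w. w \<in> Z \<longrightarrow> (\<forall>n. lex_preferred_at (fst p) (snd p) w n))}"
    by (auto simp: lex_closest_def)
  also have "closedin ?P \<dots>"
    by (intro closedin_Collect_conj closedin_continuous_map_preimage[OF continuous_map_snd assms(1)]
        closedin_Collect_all closedin_Collect_imp closedin_lex_preferred_at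
        continuous_map_fst continuous_map_snd)
  finally have "continuous_map cantor_space cantor_space r"
    using metrizable_compactum_cantor_space
    by (intro continuous_map_from_closed_graph) (auto simp: metrizable_compactum_def)
  moreover have "r s \<in> Z" for s
    using r[of s] unfolding lex_closest_def by blast
  moreover have "r z = z" if "z \<in> Z" for z
  proof -
    have "lex_closest Z z z"
      using that unfolding lex_closest_def lex_preferred_at_def by blast
    then show ?thesis
      using lex_closest_unique r by blast
  qed
  ultimately show thesis
    using that by (auto simp: continuous_map_in_subtopology)
qed

text \<open>
  The Alexandroff--Hausdorff theorem. With \<open>K\<close> embedded in the Hilbert cube, a point of \<open>K\<close> is
  described by Dedekind cuts: for each coordinate \<open>i\<close> and rational \<open>q\<close> one bit states \<open>x\<^sub>i \<le> q\<close> or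
  \<open>q \<le> x\<^sub>i\<close>. Since both inequalities are weak, the relation between bit sequences and points is
  closed; since the rationals are dense, a bit sequence describes at most one point. Hence the
  sequences that describe some point form a closed set \<open>Z\<close> that maps continuously onto \<open>K\<close>,
  and composing with a retraction onto \<open>Z\<close> gives a map defined on the whole Cantor space.
\<close>

lemma metrizable_compactum_image_of_cantor_space:
  assumes K: "metrizable_compactum K" and "topspace K \<noteq> {}"
  obtains c where "continuous_map cantor_space K c" "range c = topspace K"
proof -
  obtain e where e: "embedding_map K hilbert_cube e"
    using metrizable_compactum_embeds_in_hilbert_cube[OF K] .
  then have e_cont: "continuous_map K euclideanreal (\<lambda>x. e x i)" for i
    using homeomorphic_imp_continuous_map continuous_map_into_fulltopology
      continuous_map_into_hilbert_cube unfolding embedding_map_def by blast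
  have e_inj: "inj_on e (topspace K)"
    using e homeomorphic_imp_injective_map unfolding embedding_map_def by blast
  define q :: "nat \<Rightarrow> real" where "q = from_nat_into \<rat>"
  have q: "range q = \<rat>"
    unfolding q_def using Rats_0 by (intro range_from_nat_into countable_rat) blast
  \<comment> \<open>For \<open>e x i = q j\<close> both values of the bit are admitted; this makes the relation closed.\<close>
  define cut where "cut = (\<lambda>s x. \<forall>i j. (\<not> s (prod_encode (i, j)) \<or> e x i \<le> q j) \<and>
    (s (prod_encode (i, j)) \<or> q j \<le> e x i))"
  let ?P = "prod_topology cantor_space K"
  define G where "G = {p \<in> topspace ?P. cut (fst p) (snd p)}"
  have "closedin ?P G"
  proof -
    have "continuous_map ?P euclideanreal (\<lambda>p. e (snd p) i)" for i
      using continuous_map_compose[OF continuous_map_snd e_cont] by (simp add: o_def)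
    moreover have "closedin ?P {p \<in> topspace ?P. fst p n}" "closedin ?P {p \<in> topspace ?P. \<not> fst p n}" for n
      using closedin_cantor_coordinate[OF continuous_map_fst, where n = n and b = True]
        closedin_cantor_coordinate[OF continuous_map_fst, where n = n and b = False] by simp_all
    ultimately show ?thesis
      unfolding G_def cut_def
      by (intro closedin_Collect_all closedin_Collect_conj closedin_Collect_disj closedin_le_constant)
  qed
  have cut_unique: "x = y" if "cut s x" "cut s y" "x \<in> topspace K" "y \<in> topspace K" for s x y
  proof -
    have le: "e y i \<le> e x i" if "cut s x" "cut s y" for x y i
    proof (rule ccontr)
      assume "\<not> e y i \<le> e x i"
      then obtain r where "r \<in> \<rat>" "e x i < r" "r < e y i"
        using Rats_dense_in_real[of "e x i" "e y i"] by auto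
      moreover then obtain j where "r = q j"
        using q by (metis imageE)
      ultimately show False
        using that unfolding cut_def by (meson not_less)
    qed
    have "e x = e y"
      using le that by (intro ext antisym) blast+
    then show ?thesis
      using e_inj that by (meson inj_onD)
  qed
  have cut_exists: "\<exists>s. cut s x" for x
  proof
    show "cut (\<lambda>n. e x (fst (prod_decode n)) \<le> q (snd (prod_decode n))) x"
      unfolding cut_def by auto
  qed
  define Z where "Z = fst ` G"
  have "closedin cantor_space Z"
    using Abstract_Topological_Spaces.closed_map_fst K \<open>closedin ?P G\<close>
    unfolding Z_def closed_map_def metrizable_compactum_def by blast
  have "\<exists>x. x \<in> topspace K \<and> cut s x" if "s \<in> Z" for s
    using that unfolding Z_def G_def by auto
  then obtain g where g: "\<And>s. s \<in> Z \<Longrightarrow> g s \<in> topspace K \<and> cut s (g s)"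
    by metis
  have in_Z: "s \<in> Z" if "cut s x" "x \<in> topspace K" for s x
    using that unfolding Z_def G_def by (intro image_eqI[of _ _ "(s, x)"]) auto
  have "{(s, x). s \<in> topspace (subtopology cantor_space Z) \<and> x = g s} = G"
    using g in_Z cut_unique unfolding G_def by auto
  moreover have "closedin (prod_topology (subtopology cantor_space Z) K) G"
  proof -
    have "G \<subseteq> Z \<times> topspace K"
      unfolding Z_def by (auto simp: G_def image_iff)
    then show ?thesis
      using \<open>closedin ?P G\<close> unfolding prod_topology_subtopology
      by (intro closedin_subset_topspace) auto
  qed
  ultimately have "continuous_map (subtopology cantor_space Z) K g"
    using K g by (intro continuous_map_from_closed_graph) (auto simp: metrizable_compactum_def)
  moreover have "Z \<noteq> {}"
    using cut_exists in_Z \<open>topspace K \<noteq> {}\<close> by blast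
  then obtain r where r: "continuous_map cantor_space (subtopology cantor_space Z) r" "\<And>z. z \<in> Z \<Longrightarrow> r z = z"
    using closed_cantor_subspace_retract \<open>closedin cantor_space Z\<close> by blast
  ultimately have "continuous_map cantor_space K (g \<circ> r)"
    using continuous_map_compose by blast
  moreover have "topspace K \<subseteq> range (g \<circ> r)"
  proof
    fix x assume x: "x \<in> topspace K"
    then obtain s where "cut s x" using cut_exists by blast
    then have "s \<in> Z" "x = g s"
      using x in_Z g cut_unique by blast+
    then have "x = (g \<circ> r) s"
      using r(2) by simp
    then show "x \<in> range (g \<circ> r)" by blast
  qed
  moreover have "range (g \<circ> r) \<subseteq> topspace K"
    using continuous_map_image_subset_topspace[OF \<open>continuous_map cantor_space K (g \<circ> r)\<close>] by simp
  ultimately show thesis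
    using that by blast
qed

section \<open>Classes of sections\<close>

definition sections :: "'a topology \<Rightarrow> 'b topology \<Rightarrow> ('a \<times> 'b) set \<Rightarrow> 'a topology set" where
  "sections X Y F = (\<lambda>b. subtopology X (section_through X F b)) ` topspace Y"

lemma subspaces_section_through:
  "subspaces X {section_through X F b | b. b \<in> topspace Y} = sections X Y F"
  unfolding subspaces_def sections_def by blast

lemma equivalent_classes_refl: "\<C> \<approx>\<^sub>T \<C>"
  unfolding equivalent_classes_def by blast

lemma equivalent_classes_sym: "\<C> \<approx>\<^sub>T \<D> \<Longrightarrow> \<D> \<approx>\<^sub>T \<C>"
  unfolding equivalent_classes_def by blast

lemma equivalent_classes_trans: "\<C> \<approx>\<^sub>T \<D> \<Longrightarrow> \<D> \<approx>\<^sub>T \<E> \<Longrightarrow> \<C> \<approx>\<^sub>T \<E>"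
  unfolding equivalent_classes_def by (meson homeomorphic_space_trans)

lemma equivalent_classes_Un:
  "\<C> \<approx>\<^sub>T \<C>' \<Longrightarrow> \<D> \<approx>\<^sub>T \<D>' \<Longrightarrow> \<C> \<union> \<D> \<approx>\<^sub>T \<C>' \<union> \<D>'"
  unfolding equivalent_classes_def by blast

lemma equivalent_classes_UNION:
  "(\<And>i. \<C> i \<approx>\<^sub>T \<D> i) \<Longrightarrow> (\<Union>i. \<C> i) \<approx>\<^sub>T (\<Union>i. \<D> i)"
  unfolding equivalent_classes_def by blast

lemma homeomorphic_space_embedded_subspace:
  assumes "embedding_map X Y f" "S \<subseteq> topspace X"
  shows "subtopology X S homeomorphic_space subtopology Y (f ` S)"
proof -
  have "homeomorphic_map (subtopology X S) (subtopology (subtopology Y (f ` topspace X)) (f ` S)) f"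
    using assms homeomorphic_imp_surjective_map[of X "subtopology Y (f ` topspace X)" f]
    unfolding embedding_map_def by (intro homeomorphic_map_subtopologies) blast+
  moreover have "f ` topspace X \<inter> f ` S = f ` S"
    using assms(2) by blast
  ultimately show ?thesis
    by (simp add: subtopology_subtopology homeomorphic_map_imp_homeomorphic_space)
qed

text \<open>
  Pull \<open>F\<close> back along a surjection of the Cantor space onto \<open>K\<close>, and push it forward along an
  embedding of \<open>A\<close> into the Hilbert cube. Since the first map is onto and defined
  everywhere, exactly the original sections appear; parametrizing \<open>K\<close> by a proper closed subset of
  the Cantor space instead would leave empty sections over the remaining points.
\<close>

lemma sections_over_compactum:
  assumes A: "metrizable_compactum A" and K: "metrizable_compactum K" "topspace K \<noteq> {}"
    and F: "closedin (prod_topology A K) F"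
  shows "\<exists>G. closedin (prod_topology hilbert_cube cantor_space) G \<and>
    sections hilbert_cube cantor_space G \<approx>\<^sub>T sections A K F"
proof -
  obtain e where e: "embedding_map A hilbert_cube e"
    using metrizable_compactum_embeds_in_hilbert_cube[OF A] .
  have e_cont: "continuous_map A hilbert_cube e"
    using e homeomorphic_imp_continuous_map continuous_map_into_fulltopology
    unfolding embedding_map_def by blast
  obtain c where c: "continuous_map cantor_space K c" "range c = topspace K"
    using metrizable_compactum_image_of_cantor_space[OF K] .
  let ?P = "prod_topology A cantor_space" and ?Q = "prod_topology hilbert_cube cantor_space"
  define H where "H = {p \<in> topspace ?P. (fst p, c (snd p)) \<in> F}"
  define G where "G = (\<lambda>p. (e (fst p), snd p)) ` H"
  have "continuous_map ?P (prod_topology A K) (\<lambda>p. (fst p, c (snd p)))"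
    using continuous_map_compose[OF continuous_map_snd c(1)]
    by (intro continuous_map_pairedI continuous_map_fst) (simp add: o_def)
  then have "closedin ?P H"
    unfolding H_def using F by (rule closedin_continuous_map_preimage)
  moreover have "continuous_map ?P ?Q (\<lambda>p. (e (fst p), snd p))"
    using continuous_map_compose[OF continuous_map_fst e_cont]
    by (intro continuous_map_pairedI continuous_map_snd) (simp add: o_def)
  ultimately have "closedin ?Q G"
    unfolding G_def
    using T1_Spaces.continuous_imp_closed_map[of ?P ?Q]
      metrizable_compactum_prod[OF A metrizable_compactum_cantor_space]
      metrizable_compactum_imp_Hausdorff[OF metrizable_compactum_prod[OF metrizable_compactum_hilbert_cube
          metrizable_compactum_cantor_space]]
    by (simp add: closed_map_def metrizable_compactum_def)
  moreover have "section_through hilbert_cube G s = e ` section_through A F (c s)" for s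
    using continuous_map_image_subset_topspace[OF e_cont]
    unfolding section_through_def G_def H_def by (auto simp: image_iff)
  then have "subtopology A (section_through A F (c s)) homeomorphic_space
      subtopology hilbert_cube (section_through hilbert_cube G s)" for s
    using homeomorphic_space_embedded_subspace[OF e] by (simp add: section_through_def)
  then have "sections A K F \<approx>\<^sub>T sections hilbert_cube cantor_space G"
    unfolding equivalent_classes_def sections_def
    unfolding c(2)[symmetric] image_image topspace_cantor_space
    using homeomorphic_space_sym by blast
  ultimately show ?thesis
    using equivalent_classes_sym by blast
qed

section \<open>Joining countably many families\<close>

text \<open>
  The sequence \<open>0\<^sup>n 1 t\<close>. For varying \<open>n\<close> these sequences fill disjoint copies of the Cantor space
  that exhaust it except for the zero sequence, to which they converge.
\<close>

definition cantor_shift :: "nat \<Rightarrow> (nat \<Rightarrow> bool) \<Rightarrow> nat \<Rightarrow> bool" where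
  "cantor_shift n t i \<longleftrightarrow> i = n \<or> n < i \<and> t (i - Suc n)"

lemma cantor_shift_inject: "cantor_shift n t = cantor_shift m u \<longleftrightarrow> n = m \<and> t = u"
proof
  assume eq: "cantor_shift n t = cantor_shift m u"
  have "cantor_shift n t n" "cantor_shift m u m"
    by (simp_all add: cantor_shift_def)
  then have "m \<le> n" "n \<le> m"
    using eq by (metis cantor_shift_def less_imp_le order_refl)+
  then have "n = m" by simp
  moreover have "t j = u j" for j
    using fun_cong[OF eq, of "Suc (n + j)"] \<open>n = m\<close> by (simp add: cantor_shift_def)
  ultimately show "n = m \<and> t = u" by blast
qed simp

lemma cantor_shift_cases:
  obtains (zero) "s = (\<lambda>_. False)" | (shift) n t where "s = cantor_shift n t"
proof (cases "\<exists>n. s n")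
  case True
  define n where "n = (LEAST n. s n)"
  have "s n"
    using LeastI_ex[OF True] unfolding n_def .
  have "\<not> s i" if "i < n" for i
    using not_less_Least that unfolding n_def by blast
  then have "s i = cantor_shift n (\<lambda>j. s (Suc n + j)) i" for i
    using \<open>s n\<close> by (cases i n rule: linorder_cases) (simp_all add: cantor_shift_def)
  then show thesis
    using shift by blast
next
  case False
  then show thesis
    using zero by blast
qed

lemma continuous_map_cantor_shift: "continuous_map cantor_space cantor_space (cantor_shift n)"
  unfolding continuous_map_into_cantor_space
proof
  fix i
  have t: "continuous_map cantor_space (discrete_topology UNIV) (\<lambda>t. t j)" for j
    using continuous_map_into_cantor_space[THEN iffD1, OF continuous_map_id] by simp
  show "continuous_map cantor_space (discrete_topology UNIV) (\<lambda>t. cantor_shift n t i)"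
    by (cases i n rule: linorder_cases) (simp_all add: cantor_shift_def t)
qed

text \<open>
  The homothety with centre \<open>p\<close> and ratio \<open>1 / (n + 1)\<close>.
\<close>

definition contraction :: "(nat \<Rightarrow> real) \<Rightarrow> nat \<Rightarrow> (nat \<Rightarrow> real) \<Rightarrow> nat \<Rightarrow> real" where
  "contraction p n x i = p i + (x i - p i) / Suc n"

lemma contraction_in_hilbert_cube:
  assumes "p \<in> topspace hilbert_cube" "x \<in> topspace hilbert_cube"
  shows "contraction p n x \<in> topspace hilbert_cube"
proof -
  have eq: "contraction p n x i = (1 - 1 / Suc n) * p i + 1 / Suc n * x i" for i
    by (simp add: contraction_def diff_divide_distrib algebra_simps)
  have "0 \<le> p i" "p i \<le> 1" "0 \<le> x i" "x i \<le> 1" for i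
    using assms by (auto simp: topspace_hilbert_cube)
  then have "0 \<le> contraction p n x i" "contraction p n x i \<le> 1" for i
    unfolding eq by (intro add_nonneg_nonneg mult_nonneg_nonneg convex_bound_le; simp)+
  then show ?thesis
    by (simp add: topspace_hilbert_cube)
qed

lemma contraction_dist_le:
  assumes "p \<in> topspace hilbert_cube" "x \<in> topspace hilbert_cube"
  shows "\<bar>contraction p n x i - p i\<bar> \<le> 1 / Suc n"
proof -
  have "\<bar>x i - p i\<bar> \<le> 1"
    using assms by (auto simp: topspace_hilbert_cube abs_le_iff) (smt (verit))+
  then show ?thesis
    by (simp add: contraction_def divide_right_mono)
qed

lemma embedding_map_contraction:
  assumes "p \<in> topspace hilbert_cube"
  shows "embedding_map hilbert_cube hilbert_cube (contraction p n)"
proof (rule T1_Spaces.continuous_imp_embedding_map)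
  have "continuous_map hilbert_cube euclideanreal (\<lambda>x. x i)" for i
    using continuous_map_into_hilbert_cube[THEN iffD1, OF continuous_map_id] by simp
  then have "continuous_map hilbert_cube euclideanreal (\<lambda>x. contraction p n x i)" for i
    unfolding contraction_def by (intro continuous_intros) auto
  then show "continuous_map hilbert_cube hilbert_cube (contraction p n)"
    unfolding continuous_map_into_hilbert_cube
    using contraction_in_hilbert_cube[OF assms] by (auto simp: topspace_hilbert_cube)
  show "inj_on (contraction p n) (topspace hilbert_cube)"
    by (rule inj_onI) (simp add: contraction_def fun_eq_iff)
qed (use metrizable_compactum_hilbert_cube metrizable_compactum_imp_Hausdorff in
    \<open>auto simp: metrizable_compactum_def\<close>)

lemma sections_empty: "topspace Y \<noteq> {} \<Longrightarrow> sections X Y {} = {subtopology X {}}"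
  by (simp add: sections_def section_through_def image_constant_conv)

text \<open>
  Fix a nonempty section \<open>X\<close> of one of the sets, over a parameter \<open>u\<close>, and a point \<open>p\<close> in it. Over
  the \<open>n\<close>-th copy of the Cantor space put the \<open>n\<close>-th set, shrunk towards \<open>p\<close> by the factor
  \<open>1 / (n + 1)\<close>, and over the zero sequence put \<open>X\<close>. The shrunken sections accumulate at \<open>p\<close> only,
  and \<open>p\<close> belongs to \<open>X\<close>, so the union is closed; and the section over the limit parameter is one
  of the given spaces, so no new space appears.

  Closedness is proved by writing the set as an intersection: the set \<open>T n\<close> is the \<open>n\<close>-th
  shrunken piece, and \<open>L n\<close> is a closed set that contains all later pieces and the part over the
  zero sequence; the sets \<open>L n\<close> have only the latter in common.
\<close>

lemma sections_countable_union:
  fixes F :: "nat \<Rightarrow> ((nat \<Rightarrow> real) \<times> (nat \<Rightarrow> bool)) set"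
  assumes F: "\<And>n. closedin cube_family (F n)"
  shows "\<exists>G. closedin cube_family G \<and>
    sections hilbert_cube cantor_space G \<approx>\<^sub>T (\<Union>n. sections hilbert_cube cantor_space (F n))"
proof (cases "\<forall>n. F n = {}")
  case True
  then show ?thesis
    using equivalent_classes_refl by (intro exI[of _ "{}"]) (simp add: sections_empty)
next
  case False
  then obtain k p u where p: "(p, u) \<in> F k"
    by auto
  have F_sub: "x \<in> topspace hilbert_cube" if "(x, t) \<in> F n" for x t n
    using closedin_subset[OF F, of n] that by auto
  have p_cube: "p \<in> topspace hilbert_cube"
    using F_sub p .
  define T where "T = (\<lambda>n. (\<lambda>q. (contraction p n (fst q), cantor_shift n (snd q))) ` F n)"
  define L where "L = (\<lambda>n. {q \<in> topspace cube_family. (\<forall>i. i \<le> n \<longrightarrow> snd q i = False) \<and>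
      ((fst q, u) \<in> F k \<or> (\<forall>i. fst q i - p i \<le> 1 / Suc (Suc n) \<and> p i - fst q i \<le> 1 / Suc (Suc n)))})"
  define G where "G = (\<Inter>n. (\<Union>m\<in>{..n}. T m) \<union> L n)"
  have "closedin cube_family (T n)" for n
  proof -
    have "continuous_map cube_family cube_family (\<lambda>q. (contraction p n (fst q), cantor_shift n (snd q)))"
      using continuous_map_compose[OF continuous_map_fst, of hilbert_cube hilbert_cube "contraction p n" cantor_space]
        continuous_map_compose[OF continuous_map_snd continuous_map_cantor_shift]
        embedding_map_contraction[OF p_cube] homeomorphic_imp_continuous_map
        continuous_map_into_fulltopology
      unfolding embedding_map_def
      by (intro continuous_map_pairedI) (fastforce simp add: o_def)+
    then show ?thesis
      unfolding T_def
      using T1_Spaces.continuous_imp_closed_map[of cube_family cube_family] F[of n]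
        metrizable_compactum_prod[OF metrizable_compactum_hilbert_cube metrizable_compactum_cantor_space]
        metrizable_compactum_imp_Hausdorff
      by (auto simp: closed_map_def metrizable_compactum_def)
  qed
  moreover have "closedin cube_family (L n)" for n
  proof -
    have coord: "continuous_map cube_family euclideanreal (\<lambda>q. fst q i)" for i
      using continuous_map_fst[of hilbert_cube cantor_space] by (simp add: continuous_map_into_hilbert_cube)
    have "continuous_map cube_family cube_family (\<lambda>q. (fst q, u))"
      by (intro continuous_map_pairedI continuous_map_fst) simp
    then have "closedin cube_family {q \<in> topspace cube_family. (fst q, u) \<in> F k}"
      using F by (rule closedin_continuous_map_preimage)
    moreover have "continuous_map cube_family euclideanreal (\<lambda>q. fst q i - p i)"
      "continuous_map cube_family euclideanreal (\<lambda>q. p i - fst q i)" for i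
      using coord by (intro continuous_intros; simp)+
    ultimately show ?thesis
      unfolding L_def
      by (intro closedin_Collect_conj closedin_Collect_all closedin_Collect_imp closedin_Collect_disj
          closedin_cantor_coordinate continuous_map_snd closedin_le_constant)
  qed
  ultimately have "closedin cube_family G"
    unfolding G_def by (intro closedin_INT closedin_Un closedin_Union) auto
  have G_shift: "(y, cantor_shift n t) \<in> G \<longleftrightarrow> y \<in> contraction p n ` section_through hilbert_cube (F n) t"
    for y n t
  proof
    assume "(y, cantor_shift n t) \<in> G"
    then have "(y, cantor_shift n t) \<in> (\<Union>m\<in>{..n}. T m) \<union> L n"
      unfolding G_def by blast
    moreover have "(y, cantor_shift n t) \<notin> L n"
      by (auto simp: L_def cantor_shift_def)
    ultimately show "y \<in> contraction p n ` section_through hilbert_cube (F n) t"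
      using F_sub by (fastforce simp: T_def cantor_shift_inject section_through_def)
  next
    assume "y \<in> contraction p n ` section_through hilbert_cube (F n) t"
    then obtain x where x: "(x, t) \<in> F n" and y: "y = contraction p n x"
      by (auto simp: section_through_def)
    then have "(y, cantor_shift n t) \<in> T n"
      by (force simp: T_def)
    moreover have "(y, cantor_shift n t) \<in> L m" if "m < n" for m
    proof -
      have "\<bar>y i - p i\<bar> \<le> 1 / Suc (Suc m)" for i
      proof -
        have "\<bar>y i - p i\<bar> \<le> 1 / Suc n"
          unfolding y using contraction_dist_le[OF p_cube F_sub[OF x]] .
        also have "\<dots> \<le> 1 / Suc (Suc m)"
          using that by (simp add: frac_le)
        finally show ?thesis .
      qed
      then have "\<forall>i. y i - p i \<le> 1 / Suc (Suc m) \<and> p i - y i \<le> 1 / Suc (Suc m)"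
        by (simp add: abs_le_iff)
      then show ?thesis
        using that contraction_in_hilbert_cube[OF p_cube F_sub[OF x]]
        by (auto simp: L_def cantor_shift_def y)
    qed
    ultimately show "(y, cantor_shift n t) \<in> G"
      unfolding G_def by (blast intro: leI)
  qed
  have G_zero: "(y, \<lambda>_. False) \<in> G \<longleftrightarrow> y \<in> section_through hilbert_cube (F k) u" for y
  proof
    assume "(y, \<lambda>_. False) \<in> G"
    moreover have "(y, \<lambda>_. False) \<notin> T m" for m
      by (auto simp: T_def cantor_shift_def fun_eq_iff)
    ultimately have L: "(y, \<lambda>_. False) \<in> L n" for n
      unfolding G_def by blast
    have "y = p" if "(y, u) \<notin> F k"
    proof
      fix i
      have le: "\<bar>y i - p i\<bar> \<le> 1 / Suc (Suc n)" for n
        using L[of n] that by (auto simp: L_def abs_le_iff)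
      show "y i = p i"
      proof (rule ccontr)
        assume "y i \<noteq> p i"
        then obtain n where "1 / Suc n < \<bar>y i - p i\<bar>"
          using nat_approx_posE[of "\<bar>y i - p i\<bar>"] by auto
        moreover have "1 / Suc (Suc n) \<le> (1 / Suc n :: real)"
          by (simp add: frac_le)
        ultimately show False
          using le[of n] by linarith
      qed
    qed
    then show "y \<in> section_through hilbert_cube (F k) u"
      using p F_sub by (auto simp: section_through_def)
  next
    assume "y \<in> section_through hilbert_cube (F k) u"
    then have "(y, \<lambda>_. False) \<in> L n" for n
      by (auto simp: L_def section_through_def)
    then show "(y, \<lambda>_. False) \<in> G"
      unfolding G_def by blast
  qed
  have sec_shift: "subtopology hilbert_cube (section_through hilbert_cube (F n) t) homeomorphic_space
      subtopology hilbert_cube (section_through hilbert_cube G (cantor_shift n t))" for n t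
  proof -
    have "section_through hilbert_cube G (cantor_shift n t)
        = contraction p n ` section_through hilbert_cube (F n) t"
      using G_shift contraction_in_hilbert_cube[OF p_cube] by (auto simp: section_through_def)
    then show ?thesis
      using homeomorphic_space_embedded_subspace[OF embedding_map_contraction[OF p_cube]]
      by (simp add: section_through_def)
  qed
  have sec_zero: "section_through hilbert_cube G (\<lambda>_. False) = section_through hilbert_cube (F k) u"
    using G_zero by (auto simp: section_through_def)
  have "\<exists>Y\<in>(\<Union>n. sections hilbert_cube cantor_space (F n)).
      subtopology hilbert_cube (section_through hilbert_cube G s) homeomorphic_space Y" for s
  proof (cases s rule: cantor_shift_cases)
    case zero
    then show ?thesis
      using sec_zero by (auto simp: sections_def)
  next
    case (shift n t)
    then show ?thesis
      using sec_shift[of n t] homeomorphic_space_sym by (auto simp: sections_def)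
  qed
  moreover have "\<exists>Y\<in>sections hilbert_cube cantor_space G. X homeomorphic_space Y"
    if "X \<in> (\<Union>n. sections hilbert_cube cantor_space (F n))" for X
    using that sec_shift by (auto simp: sections_def)
  ultimately have "sections hilbert_cube cantor_space G \<approx>\<^sub>T (\<Union>n. sections hilbert_cube cantor_space (F n))"
    unfolding equivalent_classes_def by (auto simp: sections_def)
  then show ?thesis
    using \<open>closedin cube_family G\<close> by blast
qed

section \<open>Families with a \<open>\<sigma>\<close>-compact space of parameters\<close>

text \<open>
  The space \<open>B\<close> need not be compact, so it need not be a continuous image of the Cantor space. But
  it is a countable union of compact pieces, and the families over the pieces can be joined.
\<close>

lemma sections_over_sigma_compact:
  assumes A: "metrizable_compactum A" and B: "metrizable_space B" "sigma_compact_space B" "topspace B \<noteq> {}"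
    and F: "closedin (prod_topology A B) F"
  shows "\<exists>G. closedin cube_family G \<and> sections hilbert_cube cantor_space G \<approx>\<^sub>T sections A B F"
proof -
  obtain K :: "nat \<Rightarrow> 'b set" where K: "\<And>n. compactin B (K n)" "topspace B = (\<Union>n. K n)"
    using B(2) unfolding sigma_compact_space_def by blast
  obtain b where b: "b \<in> topspace B"
    using B(3) by blast
  \<comment> \<open>Adding a point makes every piece nonempty, hence a continuous image of the Cantor space.\<close>
  define K' where "K' = (\<lambda>n. insert b (K n))"
  have K': "compactin B (K' n)" for n
    using compactin_Un[of B "{b}" "K n"] K(1) b unfolding K'_def by simp
  have K'_sub: "K' n \<subseteq> topspace B" for n
    using K' compactin_subset_topspace by blast
  have "\<exists>G. closedin cube_family G \<and>
      sections hilbert_cube cantor_space G \<approx>\<^sub>T sections A (subtopology B (K' n)) (F \<inter> topspace A \<times> K' n)" for n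
  proof (rule sections_over_compactum[OF A])
    show "metrizable_compactum (subtopology B (K' n))"
      using K' B(1) compact_space_subtopology metrizable_space_subtopology
      unfolding metrizable_compactum_def by blast
    show "topspace (subtopology B (K' n)) \<noteq> {}"
      using b unfolding K'_def by auto
    show "closedin (prod_topology A (subtopology B (K' n))) (F \<inter> topspace A \<times> K' n)"
      using F unfolding prod_topology_subtopology closedin_subtopology by blast
  qed
  then obtain G where G: "\<And>n. closedin cube_family (G n)" "\<And>n. sections hilbert_cube cantor_space (G n)
      \<approx>\<^sub>T sections A (subtopology B (K' n)) (F \<inter> topspace A \<times> K' n)"
    by metis
  obtain H where H: "closedin cube_family H"
    "sections hilbert_cube cantor_space H \<approx>\<^sub>T (\<Union>n. sections hilbert_cube cantor_space (G n))"
    using sections_countable_union[of G] G(1) by blast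
  have "section_through A (F \<inter> topspace A \<times> K' n) c = section_through A F c" if "c \<in> K' n" for n c
    using that unfolding section_through_def by blast
  then have "sections A (subtopology B (K' n)) (F \<inter> topspace A \<times> K' n) =
      (\<lambda>b. subtopology A (section_through A F b)) ` K' n" for n
    using K'_sub[of n] unfolding sections_def by (simp add: inf.absorb2)
  then have "(\<Union>n. sections A (subtopology B (K' n)) (F \<inter> topspace A \<times> K' n)) =
      (\<lambda>b. subtopology A (section_through A F b)) ` (\<Union>n. K' n)"
    by blast
  also have "(\<Union>n. K' n) = topspace B"
    using K(2) b unfolding K'_def by blast
  finally have "(\<Union>n. sections A (subtopology B (K' n)) (F \<inter> topspace A \<times> K' n)) = sections A B F"
    unfolding sections_def .
  then show ?thesis
    using equivalent_classes_trans[OF H(2) equivalent_classes_UNION[OF G(2)]] H(1) by auto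
qed

section \<open>Compactifiable classes\<close>

lemma homeomorphic_copy_along_injection:
  assumes "inj_on j (topspace X)"
  obtains Y where "homeomorphic_map X Y j"
proof -
  define h where "h = inv_into (topspace X) j"
  have hj: "h (j x) = x" if "x \<in> topspace X" for x
    using assms that unfolding h_def by (rule inv_into_f_f)
  let ?Y = "pullback_topology (j ` topspace X) h X"
  have top: "topspace ?Y = j ` topspace X"
    using hj by (auto simp: topspace_pullback_topology)
  have "continuous_map X ?Y j"
    using hj by (intro continuous_map_pullback') (auto simp: o_def intro: continuous_map_eq[OF continuous_map_id])
  moreover have "continuous_map ?Y X h"
    using continuous_map_pullback[OF continuous_map_id, of "j ` topspace X" h X] by simp
  ultimately have "homeomorphic_maps X ?Y j h"
    using hj top by (auto simp: homeomorphic_maps_def)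
  then show thesis
    using that homeomorphic_map_maps by blast
qed

text \<open>
  The type of points is irrelevant as long as it is large enough: both spaces are copied along
  injections, and a fibre of the copied map is the copy of a fibre.
\<close>

lemma compactifiable_change_of_points:
  fixes A :: "'x topology" and B :: "'y topology" and j :: "'x \<Rightarrow> 'u" and k :: "'y \<Rightarrow> 'u"
  assumes A: "metrizable_compactum A" and B: "metrizable_compactum B" and q: "continuous_map A B q"
    and "inj j" "inj k"
    and \<C>: "(\<lambda>b. subtopology A (fibre A q b)) ` topspace B \<approx>\<^sub>T \<C>"
  shows "compactifiable TYPE('u) \<C>"
proof -
  obtain A' where j: "homeomorphic_map A A' j"
    by (rule homeomorphic_copy_along_injection[OF inj_on_subset[OF \<open>inj j\<close> subset_UNIV]])
  obtain B' where k: "homeomorphic_map B B' k"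
    by (rule homeomorphic_copy_along_injection[OF inj_on_subset[OF \<open>inj k\<close> subset_UNIV]])
  obtain h where h: "homeomorphic_maps A A' j h"
    using j homeomorphic_map_maps by blast
  have A'_top: "topspace A' = j ` topspace A" and B'_top: "topspace B' = k ` topspace B"
    using homeomorphic_imp_surjective_map[OF j] homeomorphic_imp_surjective_map[OF k] by simp_all
  have "A homeomorphic_space A'" "B homeomorphic_space B'"
    using j k by (auto intro: homeomorphic_map_imp_homeomorphic_space)
  then have "metrizable_compactum A'" "metrizable_compactum B'"
    using A B homeomorphic_compact_space homeomorphic_metrizable_space
    unfolding metrizable_compactum_def by blast+
  moreover have "continuous_map A' B' (k \<circ> q \<circ> h)"
    using h q homeomorphic_imp_continuous_map[OF k] unfolding homeomorphic_maps_def
    by (meson continuous_map_compose)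
  moreover have "fibre A' (k \<circ> q \<circ> h) (k b) = j ` fibre A q b" for b
    using h \<open>inj k\<close> unfolding fibre_def A'_top homeomorphic_maps_def
    by (auto simp: inj_eq)
  then have "subtopology A (fibre A q b) homeomorphic_space subtopology A' (fibre A' (k \<circ> q \<circ> h) (k b))" for b
    using homeomorphic_space_embedded_subspace[of A A' j "fibre A q b"] j
    by (auto simp: fibre_def simp flip: surjective_embedding_map)
  then have "(\<lambda>b. subtopology A' (fibre A' (k \<circ> q \<circ> h) b)) ` topspace B' \<approx>\<^sub>T
      (\<lambda>b. subtopology A (fibre A q b)) ` topspace B"
    unfolding equivalent_classes_def B'_top using homeomorphic_space_sym by blast
  then have "(\<lambda>b. subtopology A' (fibre A' (k \<circ> q \<circ> h) b)) ` topspace B' \<approx>\<^sub>T \<C>"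
    using \<C> equivalent_classes_trans by blast
  moreover have "subspaces A' {fibre A' (k \<circ> q \<circ> h) b | b. b \<in> topspace B'} =
      (\<lambda>b. subtopology A' (fibre A' (k \<circ> q \<circ> h) b)) ` topspace B'"
    unfolding subspaces_def by blast
  ultimately show ?thesis
    unfolding compactifiable_def
    by (intro exI[of _ A'] exI[of _ B'] exI[of _ "k \<circ> q \<circ> h"] conjI) simp_all
qed

lemma injection_of_cube_family_points:
  assumes "(UNIV :: real set) \<lesssim> (UNIV :: 'u set)"
  obtains j :: "(nat \<Rightarrow> real) \<times> (nat \<Rightarrow> bool) \<Rightarrow> 'u" where "inj j"
proof -
  obtain f :: "real \<Rightarrow> nat set" where f: "inj f"
    using nat_sets_eqpoll_reals eqpoll_sym eqpoll_imp_lepoll unfolding lepoll_def by blast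
  have "(UNIV :: nat set set) \<lesssim> (UNIV :: 'u set)"
    using nat_sets_eqpoll_reals eqpoll_imp_lepoll assms lepoll_trans by blast
  then obtain g :: "nat set \<Rightarrow> 'u" where g: "inj g"
    unfolding lepoll_def by blast
  \<comment> \<open>A point is turned into a sequence of sets of naturals, and the sequence into a single set.\<close>
  define seq where "seq = (\<lambda>(x, s) i. case i of 0 \<Rightarrow> {n. s n :: bool} | Suc m \<Rightarrow> f (x m))"
  define code :: "(nat \<Rightarrow> nat set) \<Rightarrow> nat set" where "code = (\<lambda>y. {prod_encode (i, n) | i n. n \<in> y i})"
  have "inj seq"
  proof (rule injI, clarify)
    fix x s y t assume eq: "seq (x, s) = seq (y, t)"
    have "{n. s n} = {n. t n}"
      using fun_cong[OF eq, of 0] by (simp add: seq_def)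
    moreover have "x m = y m" for m
      using fun_cong[OF eq, of "Suc m"] f by (simp add: seq_def inj_eq)
    ultimately show "x = y \<and> s = t"
      by (auto simp: set_eq_iff)
  qed
  moreover have "inj code"
  proof (rule injI, rule ext)
    fix y z i assume eq: "code y = code z"
    have "y i = {n. prod_encode (i, n) \<in> code y}" for y
      by (auto simp: code_def)
    then show "y i = z i"
      using eq by metis
  qed
  ultimately have "inj (g \<circ> code \<circ> seq)"
    using g by (simp add: inj_compose)
  then show thesis
    using that by blast
qed

lemma homeomorphic_space_topspace_empty:
  "X homeomorphic_space Y \<Longrightarrow> topspace X = {} \<longleftrightarrow> topspace Y = {}"
  using homeomorphic_empty_space by auto

text \<open>
  The fibres of \<open>q\<close> are the sections of its graph.
\<close>

lemma compactifiable_imp_family: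
  assumes "compactifiable TYPE('u) \<C>"
  shows "\<exists>(A :: 'u topology) (B :: 'u topology) F. metrizable_compactum A \<and>
     metrizable_space B \<and> sigma_compact_space B \<and> closedin (prod_topology A B) F \<and>
     sections A B F \<approx>\<^sub>T \<C>"
proof -
  obtain A B :: "'u topology" and q where AB: "metrizable_compactum A" "metrizable_compactum B"
    and q: "continuous_map A B q"
    and \<C>: "subspaces A {fibre A q b | b. b \<in> topspace B} \<approx>\<^sub>T \<C>"
    using assms unfolding compactifiable_def by blast
  define F where "F = {p \<in> topspace (prod_topology A B). q (fst p) = snd p}"
  have "closedin (prod_topology A B) F"
    unfolding F_def
    using closedin_continuous_maps_eq[OF metrizable_compactum_imp_Hausdorff[OF AB(2)]
        continuous_map_compose[OF continuous_map_fst q] continuous_map_snd]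
    by (simp add: o_def)
  moreover have "section_through A F b = fibre A q b" if "b \<in> topspace B" for b
    using that unfolding F_def section_through_def fibre_def by auto
  then have "{section_through A F b | b. b \<in> topspace B} = {fibre A q b | b. b \<in> topspace B}"
    by metis
  then have "sections A B F \<approx>\<^sub>T \<C>"
    using \<C> by (simp flip: subspaces_section_through)
  moreover have "sigma_compact_space B"
    using AB(2) unfolding sigma_compact_space_def metrizable_compactum_def compact_space_def
    by (intro exI[of _ "\<lambda>_. topspace B"]) simp
  moreover have "metrizable_space B"
    using AB unfolding metrizable_compactum_def by blast
  ultimately show ?thesis
    using AB(1) by (intro exI[of _ A] exI[of _ B] exI[of _ F] conjI)
qed

text \<open>
  The kernel of \<open>q\<close> is the equivalence relation. Its classes are the nonempty fibres, since the class
  of \<open>a\<close> is the fibre over \<open>q a\<close>.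
\<close>

lemma compactifiable_imp_equivalence_relation:
  assumes "compactifiable TYPE('u) \<C>"
  shows "\<exists>(A :: 'u topology) E. metrizable_compactum A \<and>
     equiv (topspace A) E \<and> closedin (prod_topology A A) E \<and>
     sections A A E \<approx>\<^sub>T {X \<in> \<C>. topspace X \<noteq> {}}"
proof -
  obtain A B :: "'u topology" and q where AB: "metrizable_compactum A" "metrizable_compactum B"
    and q: "continuous_map A B q"
    and \<C>: "subspaces A {fibre A q b | b. b \<in> topspace B} \<approx>\<^sub>T \<C>"
    using assms unfolding compactifiable_def by blast
  define E where "E = {p \<in> topspace (prod_topology A A). q (fst p) = q (snd p)}"
  have "closedin (prod_topology A A) E"
    unfolding E_def
    using closedin_continuous_maps_eq[OF metrizable_compactum_imp_Hausdorff[OF AB(2)]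
        continuous_map_compose[OF continuous_map_fst q] continuous_map_compose[OF continuous_map_snd q]]
    by (simp add: o_def)
  moreover have "equiv (topspace A) E"
    unfolding E_def by (rule equivI) (auto simp: refl_on_def sym_def trans_def)
  moreover have sec: "section_through A E a = fibre A q (q a)" if "a \<in> topspace A" for a
    using that unfolding E_def section_through_def fibre_def by auto
  have "sections A A E \<approx>\<^sub>T {X \<in> \<C>. topspace X \<noteq> {}}"
    unfolding equivalent_classes_def
  proof (intro conjI ballI)
    fix X assume "X \<in> sections A A E"
    then obtain a where a: "a \<in> topspace A" "X = subtopology A (fibre A q (q a))"
      using sec by (auto simp: sections_def)
    moreover have "q a \<in> topspace B"
      using a(1) q by (meson continuous_map_def funcset_mem)
    ultimately obtain Y where Y: "Y \<in> \<C>" "X homeomorphic_space Y"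
      using \<C> unfolding equivalent_classes_def subspaces_def by blast
    have "a \<in> topspace X"
      using a by (simp add: fibre_def)
    then have "topspace Y \<noteq> {}"
      using homeomorphic_space_topspace_empty[OF Y(2)] by blast
    then show "\<exists>Y\<in>{X \<in> \<C>. topspace X \<noteq> {}}. X homeomorphic_space Y"
      using Y by blast
  next
    fix Y assume Y: "Y \<in> {X \<in> \<C>. topspace X \<noteq> {}}"
    then obtain b where b: "Y homeomorphic_space subtopology A (fibre A q b)"
      using \<C> unfolding equivalent_classes_def subspaces_def by blast
    have "topspace (subtopology A (fibre A q b)) \<noteq> {}"
      using homeomorphic_space_topspace_empty[OF b] Y by blast
    then obtain a where "a \<in> topspace A" "q a = b"
      by (auto simp: fibre_def)
    then show "\<exists>X\<in>sections A A E. Y homeomorphic_space X"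
      using b sec unfolding sections_def by auto
  qed
  ultimately show ?thesis
    using AB(1) by (intro exI[of _ A] exI[of _ E] conjI)
qed

text \<open>
  The set \<open>F\<close> itself is compact, and the fibre over \<open>s\<close> of its projection to the Cantor space is
  the section of \<open>F\<close> through \<open>s\<close>, placed at height \<open>s\<close>.
\<close>

lemma cube_family_imp_compactifiable:
  assumes u: "(UNIV :: real set) \<lesssim> (UNIV :: 'u set)"
    and F: "closedin cube_family F" "sections hilbert_cube cantor_space F \<approx>\<^sub>T \<C>"
  shows "compactifiable TYPE('u) \<C>"
proof -
  obtain j :: "(nat \<Rightarrow> real) \<times> (nat \<Rightarrow> bool) \<Rightarrow> 'u" where j: "inj j"
    using injection_of_cube_family_points[OF u] .
  have k: "inj (\<lambda>s. j (\<lambda>_. 0, s))"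
    using j by (auto simp: inj_def)
  let ?A = "subtopology cube_family F"
  have "F \<subseteq> topspace cube_family"
    using F(1) by (rule closedin_subset)
  have "subtopology hilbert_cube (section_through hilbert_cube F s) homeomorphic_space
      subtopology ?A (fibre ?A snd s)" for s
  proof -
    have "embedding_map hilbert_cube cube_family (\<lambda>x. (x, s))"
      by (rule T1_Spaces.continuous_imp_embedding_map)
        (use metrizable_compactum_hilbert_cube metrizable_compactum_imp_Hausdorff metrizable_compactum_prod
          metrizable_compactum_cantor_space in
        \<open>auto intro!: continuous_map_pairedI continuous_map_id[unfolded id_def] inj_onI simp: metrizable_compactum_def\<close>)
    then have "subtopology hilbert_cube (section_through hilbert_cube F s) homeomorphic_space
      subtopology cube_family ((\<lambda>x. (x, s)) ` section_through hilbert_cube F s)"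
      by (rule homeomorphic_space_embedded_subspace) (simp add: section_through_def)
    moreover have "(\<lambda>x. (x, s)) ` section_through hilbert_cube F s = F \<inter> fibre ?A snd s"
      using \<open>F \<subseteq> topspace cube_family\<close> unfolding section_through_def fibre_def by auto
    ultimately show ?thesis
      by (simp add: subtopology_subtopology)
  qed
  then have "(\<lambda>s. subtopology ?A (fibre ?A snd s)) ` topspace cantor_space \<approx>\<^sub>T
      sections hilbert_cube cantor_space F"
    unfolding equivalent_classes_def sections_def using homeomorphic_space_sym by blast
  then have fibres: "(\<lambda>s. subtopology ?A (fibre ?A snd s)) ` topspace cantor_space \<approx>\<^sub>T \<C>"
    using F(2) by (rule equivalent_classes_trans)
  have snd: "continuous_map ?A cantor_space snd"
    by (intro continuous_map_from_subtopology continuous_map_snd)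
  have "metrizable_compactum ?A"
    using metrizable_compactum_prod[OF metrizable_compactum_hilbert_cube metrizable_compactum_cantor_space] F(1)
    by (rule metrizable_compactum_closed_subspace)
  from compactifiable_change_of_points[OF this metrizable_compactum_cantor_space snd j k fibres]
  show ?thesis .
qed

lemma compactifiable_empty: "compactifiable TYPE('u) {}"
proof -
  let ?E = "discrete_topology {} :: 'u topology"
  have E: "metrizable_compactum ?E"
    unfolding metrizable_compactum_def
    by (simp only: compact_space_discrete_topology metrizable_space_discrete_topology finite.emptyI simp_thms)
  have none: "subspaces ?E {fibre ?E id b | b. b \<in> topspace ?E} \<approx>\<^sub>T {}"
    unfolding subspaces_def equivalent_classes_def topspace_discrete_topology by blast
  show ?thesis
    unfolding compactifiable_def
    by (rule exI[of _ ?E], rule exI[of _ ?E], rule exI[of _ id]) (intro conjI E none continuous_map_id)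
qed

lemma topspace_cantor_space_nonempty: "topspace cantor_space \<noteq> {}"
  by (simp only: topspace_cantor_space UNIV_not_empty not_False_eq_True)

lemma cube_family_add_empty:
  assumes "closedin cube_family F"
  shows "\<exists>G. closedin cube_family G \<and>
    sections hilbert_cube cantor_space G \<approx>\<^sub>T
      insert (subtopology hilbert_cube {}) (sections hilbert_cube cantor_space F)"
proof -
  have "(\<Union>n. sections hilbert_cube cantor_space (case n of 0 \<Rightarrow> {} | Suc _ \<Rightarrow> F)) =
      sections hilbert_cube cantor_space {} \<union> sections hilbert_cube cantor_space F"
    by (subst UNIV_nat_eq) simp
  moreover have "sections hilbert_cube cantor_space {} = {subtopology hilbert_cube {}}"
    by (rule sections_empty[OF topspace_cantor_space_nonempty])
  moreover have "closedin cube_family (case n of 0 \<Rightarrow> {} | Suc _ \<Rightarrow> F)" for n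
    using assms by (cases n) simp_all
  ultimately show ?thesis
    using sections_countable_union[of "\<lambda>n. case n of 0 \<Rightarrow> {} | Suc _ \<Rightarrow> F"] by simp
qed

lemma equivalent_classes_empty_iff: "\<C> \<approx>\<^sub>T \<D> \<Longrightarrow> \<C> = {} \<longleftrightarrow> \<D> = {}"
  unfolding equivalent_classes_def by blast

lemma family_imp_cube_family:
  assumes "metrizable_compactum A" "metrizable_space B" "sigma_compact_space B"
    and "closedin (prod_topology A B) F" "sections A B F \<approx>\<^sub>T \<C>" "\<C> \<noteq> {}"
  shows "\<exists>G. closedin cube_family G \<and> sections hilbert_cube cantor_space G \<approx>\<^sub>T \<C>"
proof -
  have "topspace B \<noteq> {}"
    using equivalent_classes_empty_iff[OF assms(5)] assms(6) by (auto simp: sections_def)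
  then show ?thesis
    using sections_over_sigma_compact[OF assms(1-3) _ assms(4)] equivalent_classes_trans assms(5) by blast
qed

text \<open>
  The set \<open>E\<close> is a closed family of subsets of \<open>A\<close> that is parametrized by \<open>A\<close> itself, so
  no quotient space has to be formed. Since the sections stand for the nonempty members of \<open>\<C>\<close>
  only, an empty section has to be added if \<open>\<C>\<close> contains an empty space.
\<close>

lemma equivalence_relation_imp_cube_family:
  assumes A: "metrizable_compactum A" and E: "closedin (prod_topology A A) E"
    and sec: "sections A A E \<approx>\<^sub>T {X \<in> \<C>. topspace X \<noteq> {}}" and "\<C> \<noteq> {}"
  shows "\<exists>G. closedin cube_family G \<and> sections hilbert_cube cantor_space G \<approx>\<^sub>T \<C>"
proof -
  have empties: "{subtopology hilbert_cube {}} \<approx>\<^sub>T {X \<in> \<C>. topspace X = {}}" if "X \<in> \<C>" "topspace X = {}" for X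
    unfolding equivalent_classes_def using that by (auto simp: homeomorphic_empty_space_eq)
  have split: "{X \<in> \<C>. topspace X = {}} \<union> {X \<in> \<C>. topspace X \<noteq> {}} = \<C>"
    by blast
  have "sigma_compact_space A"
    using A unfolding sigma_compact_space_def metrizable_compactum_def compact_space_def
    by (intro exI[of _ "\<lambda>_. topspace A"]) simp
  then have G: "\<exists>G. closedin cube_family G \<and> sections hilbert_cube cantor_space G \<approx>\<^sub>T {X \<in> \<C>. topspace X \<noteq> {}}"
    if "{X \<in> \<C>. topspace X \<noteq> {}} \<noteq> {}"
    using family_imp_cube_family[OF A _ _ E sec that] A unfolding metrizable_compactum_def by blast
  consider (none) "{X \<in> \<C>. topspace X \<noteq> {}} = {}" | (all) "{X \<in> \<C>. topspace X = {}} = {}"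
    | (both) "{X \<in> \<C>. topspace X \<noteq> {}} \<noteq> {}" "{X \<in> \<C>. topspace X = {}} \<noteq> {}"
    by blast
  then show ?thesis
  proof cases
    case none
    then obtain X where X: "X \<in> \<C>" "topspace X = {}"
      using \<open>\<C> \<noteq> {}\<close> by blast
    have "sections hilbert_cube cantor_space {} \<approx>\<^sub>T {X \<in> \<C>. topspace X = {}}"
      using empties[OF X] unfolding sections_empty[OF topspace_cantor_space_nonempty] .
    moreover have eq: "{X \<in> \<C>. topspace X = {}} = \<C>"
      using split unfolding none Un_empty_right .
    ultimately have "sections hilbert_cube cantor_space {} \<approx>\<^sub>T \<C>"
      unfolding eq by blast
    then show ?thesis
      using closedin_empty by blast
  next
    case all
    have eq: "{X \<in> \<C>. topspace X \<noteq> {}} = \<C>"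
      using split unfolding all Un_empty_left .
    show ?thesis
      using G[unfolded eq, OF \<open>\<C> \<noteq> {}\<close>] .
  next
    case both
    then obtain G where G: "closedin cube_family G"
      "sections hilbert_cube cantor_space G \<approx>\<^sub>T {X \<in> \<C>. topspace X \<noteq> {}}"
      using G by blast
    obtain H where H: "closedin cube_family H" "sections hilbert_cube cantor_space H \<approx>\<^sub>T
        insert (subtopology hilbert_cube {}) (sections hilbert_cube cantor_space G)"
      using cube_family_add_empty[OF G(1)] by blast
    obtain X where X: "X \<in> \<C>" "topspace X = {}"
      using both(2) by blast
    have "insert (subtopology hilbert_cube {}) (sections hilbert_cube cantor_space G) \<approx>\<^sub>T \<C>"
      using equivalent_classes_Un[OF empties[OF X] G(2)] unfolding split by simp
    then show ?thesis
      using H equivalent_classes_trans by blast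
  qed
qed

section \<open>The characterization\<close>

theorem theorem2p10:
  fixes \<C> :: "'a topology set"
  assumes "(UNIV :: real set) \<lesssim> (UNIV :: 'u set)"
  shows
    "(compactifiable TYPE('u) \<C> \<longleftrightarrow>
        (\<exists>(A :: 'u topology) E.
           metrizable_compactum A \<and>
           equiv (topspace A) E \<and> closedin (prod_topology A A) E \<and>
           subspaces A {section_through A E a | a. a \<in> topspace A}
             \<approx>\<^sub>T {X \<in> \<C>. topspace X \<noteq> {}})) \<and>
     (compactifiable TYPE('u) \<C> \<longleftrightarrow>
        (\<exists>(A :: 'u topology) (B :: 'u topology) F.
           metrizable_compactum A \<and>
           metrizable_space B \<and> sigma_compact_space B \<and>
           closedin (prod_topology A B) F \<and>
           subspaces A {section_through A F b | b. b \<in> topspace B} \<approx>\<^sub>T \<C>)) \<and>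
     (compactifiable TYPE('u) \<C> \<longleftrightarrow>
        (\<exists>F. closedin (prod_topology hilbert_cube cantor_space) F \<and>
           subspaces hilbert_cube
             {section_through hilbert_cube F b | b. b \<in> topspace cantor_space} \<approx>\<^sub>T \<C>) \<or>
        \<C> = {})"
  (is "(?i \<longleftrightarrow> ?ii) \<and> (?i \<longleftrightarrow> ?iii) \<and> (?i \<longleftrightarrow> ?iv \<or> \<C> = {})")
proof -
  have "?ii" if ?i
    unfolding subspaces_section_through
    using that by (rule compactifiable_imp_equivalence_relation)
  moreover have "?iii" if ?i
    unfolding subspaces_section_through
    using that by (rule compactifiable_imp_family)
  moreover have "?iv \<or> \<C> = {}" if ii: ?ii
  proof -
    obtain A :: "'u topology" and E where "metrizable_compactum A" "closedin (prod_topology A A) E"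
      "sections A A E \<approx>\<^sub>T {X \<in> \<C>. topspace X \<noteq> {}}"
      using ii[unfolded subspaces_section_through] by (elim exE conjE)
    then have "?iv" if "\<C> \<noteq> {}"
      unfolding subspaces_section_through using that by (rule equivalence_relation_imp_cube_family)
    then show ?thesis
      by (rule disjCI)
  qed
  moreover have "?iv \<or> \<C> = {}" if iii: ?iii
  proof -
    obtain A B :: "'u topology" and F where "metrizable_compactum A" "metrizable_space B"
      "sigma_compact_space B" "closedin (prod_topology A B) F" "sections A B F \<approx>\<^sub>T \<C>"
      using iii[unfolded subspaces_section_through] by (elim exE conjE)
    then have "?iv" if "\<C> \<noteq> {}"
      unfolding subspaces_section_through using that by (rule family_imp_cube_family)
    then show ?thesis
      by (rule disjCI)
  qed
  moreover have ?i if "?iv \<or> \<C> = {}"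
    using that unfolding subspaces_section_through
  proof (elim disjE exE conjE)
    fix F assume "closedin cube_family F" "sections hilbert_cube cantor_space F \<approx>\<^sub>T \<C>"
    then show ?i
      by (rule cube_family_imp_compactifiable[OF assms])
  next
    assume "\<C> = {}"
    then show ?i
      by (simp only: compactifiable_empty)
  qed
  ultimately have "?i \<longleftrightarrow> ?ii" "?i \<longleftrightarrow> ?iii" "?i \<longleftrightarrow> ?iv \<or> \<C> = {}"
    by argo+
  then show ?thesis
    by (intro conjI)
qed

end
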